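(* Let $a\in(0,1)$ be irrational and let $(M,g)$ be the Carter spacetime with parameter $a$. There exist points $p,q\in M$ such that their Lorentzian distance is infinite: $d(p,q)=\infty$.
   Context: Carter spacetime (with a fixed irrational parameter $a\in(0,1)$): $M$ is the quotient of $\mathbb{R}^3$, with coordinates $(t,y,z)$, by the equivalence relation generated by $(t,y,z)\sim(t,y,z+1)$ and $(t,y,z)\sim(t,y+1,z+a)$; $M$ is diffeomorphic to $\mathbb{R}\times\mathbb{T}^2$, and the coordinate $t$ is well defined on $M$. The metric $g$ on $M$ is the Lorentzian metric (signature $(+,-,-)$) induced by the metric $$ds^2=c(t)\,(dt^2-dy^2)+2\,dt\,dy-dz^2,\qquad c(t)=(\cosh t-1)^2,$$ on $\mathbb{R}^3$, which is invariant under the identifications. The time orientation is the one for which the nowhere vanishing causal vector field $\partial_t$ is future directed. Conventions: a tangent vector $v$ is timelike if $g(v,v)>0$, lightlike if $g(v,v)=0$ and $v\ne0$, and causal if it is timelike or lightlike. At each point the set of causal vectors has two connected components (causal cones); the causal vectors in the same component as $\partial_t$ are future directed. A piecewise differentiable curve is causal if its tangent vector is (nonzero and) causal on each differentiable piece and at each break the two lateral tangent vectors lie in the same causal cone; it is future directed if its tangent vectors are future directed. The length of a causal curve $\alpha:[\tau_0,\tau_1]\to M$ is $L(\alpha)=\int_{\tau_0}^{\tau_1}\sqrt{|g(\alpha'(\tau),\alpha'(\tau))|}\,d\tau$. The Lorentzian distance (time separation) is $d(p,q)=\sup_{\alpha\in C(p,q)}L(\alpha)\in[0,\infty]$, where $C(p,q)$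 is the set of all future directed piecewise differentiable causal curves from $p$ to $q$. *)

theory Defs
  imports "HOL-Analysis.Analysis"
begin

section \<open>The quotient manifold\<close>

type_synonym coords = "real \<times> real \<times> real"  \<comment> \<open>\<open>(t, y, z)\<close>\<close>

inductive carter_ident :: "real \<Rightarrow> coords \<Rightarrow> coords \<Rightarrow> bool" for a where
  "carter_ident a (t, y, z) (t, y, z + 1)"
| "carter_ident a (t, y, z) (t, y + 1, z + a)"

definition carter_rel :: "real \<Rightarrow> coords rel" where
  "carter_rel a = {(x, x'). equivclp (carter_ident a) x x'}"

definition carter_space :: "real \<Rightarrow> coords set set" where
  "carter_space a = UNIV // carter_rel a"

definition carter_proj :: "real \<Rightarrow> coords \<Rightarrow> coords set" where
  "carter_proj a x = carter_rel a `` {x}"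

lemma equiv_carter_rel: "equiv UNIV (carter_rel a)"
  unfolding carter_rel_def equiv_def refl_on_def sym_def trans_def
  by (auto intro: equivclp_sym equivclp_trans)

lemma carter_rel_iff:
  "(x, x') \<in> carter_rel a \<longleftrightarrow> (\<exists>m n :: int. x' = x + (0, of_int m, of_int n + of_int m * a))"
proof
  assume "(x, x') \<in> carter_rel a"
  then have "(symclp (carter_ident a))\<^sup>*\<^sup>* x x'"
    by (simp add: carter_rel_def equivclp_def)
  then show "\<exists>m n :: int. x' = x + (0, of_int m, of_int n + of_int m * a)"
  proof induction
    case base
    show ?case by (intro exI[of _ 0]) (simp add: zero_prod_def)
  next
    case (step u w)
    then obtain m n :: int where u: "u = x + (0, of_int m, of_int n + of_int m * a)" by blast
    have "\<exists>k l :: int. w = u + (0, of_int k, of_int l + of_int k * a)"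
      using step(2)
    proof (cases rule: symclpE)
      case base
      then show ?thesis
      proof cases
        case (1 t y z)
        then show ?thesis by (intro exI[of _ 0] exI[of _ 1]) simp
      next
        case (2 t y z)
        then show ?thesis by (intro exI[of _ 1] exI[of _ 0]) simp
      qed
    next
      case sym
      then show ?thesis
      proof cases
        case (1 t y z)
        then show ?thesis by (intro exI[of _ 0] exI[of _ "-1"]) simp
      next
        case (2 t y z)
        then show ?thesis by (intro exI[of _ "-1"] exI[of _ 0]) simp
      qed
    qed
    then obtain k l :: int where "w = u + (0, of_int k, of_int l + of_int k * a)" by blast
    with u have "w = x + (0, of_int (m + k), of_int (n + l) + of_int (m + k) * a)"
      by (cases x) (simp add: algebra_simps)
    then show ?case by blast
  qed
next
  assume "\<exists>m n :: int. x' = x + (0, of_int m, of_int n + of_int m * a)"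
  then obtain m n :: int where x': "x' = x + (0, of_int m, of_int n + of_int m * a)" by blast
  let ?E = "equivclp (carter_ident a)"
  have A: "?E (t, y, z) (t, y, z + of_int k)" for t y z and k :: int
  proof (induction k rule: int_induct[where k = 0])
    case base
    show ?case by simp
  next
    case (step1 i)
    have "?E (t, y, z + of_int i) (t, y, z + of_int i + 1)"
      by (rule r_into_equivclp, rule carter_ident.intros)
    then show ?case using step1 equivclp_trans by (simp add: add.assoc) fast
  next
    case (step2 i)
    have "?E (t, y, z + of_int (i - 1)) (t, y, z + of_int (i - 1) + 1)"
      by (rule r_into_equivclp, rule carter_ident.intros)
    then have "?E (t, y, z + of_int (i - 1)) (t, y, z + of_int i)" by simp
    then show ?case using step2 equivclp_trans equivclp_sym by fast
  qed
  have B: "?E (t, y, z) (t, y + of_int k, z + of_int k * a)" for t y z and k :: int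
  proof (induction k rule: int_induct[where k = 0])
    case base
    show ?case by simp
  next
    case (step1 i)
    have "?E (t, y + of_int i, z + of_int i * a) (t, y + of_int i + 1, z + of_int i * a + a)"
      by (rule r_into_equivclp, rule carter_ident.intros)
    then have "?E (t, y + of_int i, z + of_int i * a) (t, y + of_int (i + 1), z + of_int (i + 1) * a)"
      by (simp add: algebra_simps)
    then show ?case using step1 equivclp_trans by fast
  next
    case (step2 i)
    have "?E (t, y + of_int (i - 1), z + of_int (i - 1) * a)
        (t, y + of_int (i - 1) + 1, z + of_int (i - 1) * a + a)"
      by (rule r_into_equivclp, rule carter_ident.intros)
    then have "?E (t, y + of_int (i - 1), z + of_int (i - 1) * a) (t, y + of_int i, z + of_int i * a)"
      by (simp add: algebra_simps)
    then show ?case using step2 equivclp_trans equivclp_sym by fast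
  qed
  obtain t y z where x: "x = (t, y, z)" by (cases x)
  have "?E (t, y, z) (t, y + of_int m, z + of_int m * a + of_int n)"
    using A[of t "y + of_int m" "z + of_int m * a" n] B[of t y z m] equivclp_trans by fast
  then show "(x, x') \<in> carter_rel a"
    by (simp add: carter_rel_def x x' algebra_simps)
qed

lemma carter_proj_eq_iff: "carter_proj a x = carter_proj a x' \<longleftrightarrow> (x, x') \<in> carter_rel a"
  unfolding carter_proj_def by (rule eq_equiv_class_iff[OF equiv_carter_rel]) auto

definition carter_time :: "coords set \<Rightarrow> real" where
  "carter_time p = (THE t. \<exists>y z. (t, y, z) \<in> p)"

lemma carter_time_proj [simp]: "carter_time (carter_proj a (t, y, z)) = t"
proof -
  have "(t, y, z) \<in> carter_proj a (t, y, z)"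
    unfolding carter_proj_def by (rule equiv_class_self[OF equiv_carter_rel]) simp
  then show ?thesis
    unfolding carter_time_def
    by (intro the_equality) (auto simp: carter_proj_def carter_rel_iff)
qed

text \<open>
  The charts are the local inverses of the projection. Coordinate changes between them are locally
  translations, so the coordinate frame descends to a global frame of the tangent bundle.
  Tangent vectors at any point of the quotient are given by their components in that frame.
\<close>

definition carter_chart_range :: "real \<Rightarrow> coords set \<Rightarrow> bool" where
  "carter_chart_range a U \<longleftrightarrow> open U \<and> inj_on (carter_proj a) U"

definition has_velocity :: "real \<Rightarrow> (real \<Rightarrow> coords set) \<Rightarrow> coords \<Rightarrow> real \<Rightarrow> real set \<Rightarrow> bool" where
  "has_velocity a \<alpha> v \<tau> S \<longleftrightarrow>
    (\<exists>U. carter_chart_range a U \<and>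
      \<alpha> \<tau> \<in> carter_proj a ` U \<and>
      (\<forall>\<^sub>F s in at \<tau> within S. \<alpha> s \<in> carter_proj a ` U) \<and>
      ((\<lambda>s. inv_into U (carter_proj a) (\<alpha> s)) has_vector_derivative v) (at \<tau> within S))"

text \<open>
  For \<open>S\<close> an interval with endpoint \<open>\<tau>\<close> this is the lateral tangent vector.
\<close>

definition velocity :: "real \<Rightarrow> (real \<Rightarrow> coords set) \<Rightarrow> real \<Rightarrow> real set \<Rightarrow> coords" where
  "velocity a \<alpha> \<tau> S = (THE v. has_velocity a \<alpha> v \<tau> S)"

lemma has_velocity_unique:
  assumes v: "has_velocity a \<alpha> v \<tau> S" and w: "has_velocity a \<alpha> w \<tau> S"
    and "\<tau> \<in> S" and nontriv: "at \<tau> within S \<noteq> bot"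
  shows "v = w"
proof -
  let ?F = "at \<tau> within S" and ?\<pi> = "carter_proj a"
  obtain U where U: "\<alpha> \<tau> \<in> ?\<pi> ` U" "\<forall>\<^sub>F s in ?F. \<alpha> s \<in> ?\<pi> ` U"
    "((\<lambda>s. inv_into U ?\<pi> (\<alpha> s)) has_vector_derivative v) ?F"
    using v unfolding has_velocity_def by blast
  obtain W where W: "\<alpha> \<tau> \<in> ?\<pi> ` W" "\<forall>\<^sub>F s in ?F. \<alpha> s \<in> ?\<pi> ` W"
    "((\<lambda>s. inv_into W ?\<pi> (\<alpha> s)) has_vector_derivative w) ?F"
    using w unfolding has_velocity_def by blast
  define D where "D s = inv_into W ?\<pi> (\<alpha> s) - inv_into U ?\<pi> (\<alpha> s)" for s
  have D: "(D has_vector_derivative (w - v)) ?F"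
    unfolding D_def using W(3) U(3) by (rule has_vector_derivative_diff)
  have lattice: "\<exists>m n :: int. D s = (0, of_int m, of_int n + of_int m * a)"
    if "\<alpha> s \<in> ?\<pi> ` U" "\<alpha> s \<in> ?\<pi> ` W" for s
  proof -
    have "?\<pi> (inv_into U ?\<pi> (\<alpha> s)) = ?\<pi> (inv_into W ?\<pi> (\<alpha> s))"
      using that by (simp add: f_inv_into_f)
    then obtain m n :: int where
      "inv_into W ?\<pi> (\<alpha> s) = inv_into U ?\<pi> (\<alpha> s) + (0, of_int m, of_int n + of_int m * a)"
      unfolding carter_proj_eq_iff carter_rel_iff by blast
    then show ?thesis unfolding D_def by auto
  qed
  obtain m0 n0 :: int where D0: "D \<tau> = (0, of_int m0, of_int n0 + of_int m0 * a)"
    using lattice[OF U(1) W(1)] by blast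
  have lim: "(D \<longlongrightarrow> D \<tau>) ?F"
    using has_vector_derivative_continuous[OF D] by (simp add: continuous_within)
  have "\<forall>\<^sub>F s in ?F. dist (fst (snd (D s))) (of_int m0) < 1"
    using tendstoD[OF tendsto_fst[OF tendsto_snd[OF lim]], of 1] D0 by simp
  moreover have "\<forall>\<^sub>F s in ?F. dist (snd (snd (D s))) (of_int n0 + of_int m0 * a) < 1"
    using tendstoD[OF tendsto_snd[OF tendsto_snd[OF lim]], of 1] D0 by simp
  ultimately have const: "\<forall>\<^sub>F s in ?F. D s = D \<tau>"
    using U(2) W(2)
  proof eventually_elim
    case (elim s)
    then obtain m n :: int where Ds: "D s = (0, of_int m, of_int n + of_int m * a)"
      using lattice by blast
    have "\<bar>real_of_int (m - m0)\<bar> < 1" using elim(1) Ds by (simp add: dist_real_def)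
    then have m: "m = m0" by linarith
    have "\<bar>real_of_int (n - n0)\<bar> < 1" using elim(2) Ds m by (simp add: dist_real_def)
    then have "n = n0" by linarith
    then show ?case using m Ds D0 by simp
  qed
  have "((\<lambda>s. D \<tau>) has_derivative (\<lambda>x. x *\<^sub>R (w - v))) ?F"
    by (rule has_derivative_transform_eventually[OF D[unfolded has_vector_derivative_def] const])
      (use \<open>\<tau> \<in> S\<close> in auto)
  then have "w - v = 0"
    using nontriv by (intro vector_derivative_unique_within[of \<tau> S "\<lambda>s. D \<tau>"])
      (auto simp: has_vector_derivative_def intro!: derivative_eq_intros)
  then show ?thesis by simp
qed

lemma velocity_eq:
  "has_velocity a \<alpha> v \<tau> S \<Longrightarrow> \<tau> \<in> S \<Longrightarrow> at \<tau> within S \<noteq> bot \<Longrightarrow> velocity a \<alpha> \<tau> S = v"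
  unfolding velocity_def by (rule the_equality) (auto dest: has_velocity_unique)

section \<open>The metric and the time orientation\<close>

definition carter_c :: "real \<Rightarrow> real" where
  "carter_c t = (cosh t - 1)\<^sup>2"

text \<open>The symmetric bilinear form polarizing \<open>c(t) (dt\<^sup>2 - dy\<^sup>2) + 2 dt dy - dz\<^sup>2\<close>.\<close>

definition carter_metric :: "coords set \<Rightarrow> coords \<Rightarrow> coords \<Rightarrow> real" where
  "carter_metric p = (\<lambda>(vt, vy, vz) (wt, wy, wz).
     carter_c (carter_time p) * (vt * wt - vy * wy) + (vt * wy + vy * wt) - vz * wz)"

lemma carter_metric_quadratic:
  "carter_metric (carter_proj a (t, y, z)) (dt, dy, dz) (dt, dy, dz) =
    carter_c t * (dt\<^sup>2 - dy\<^sup>2) + 2 * dt * dy - dz\<^sup>2"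
  by (simp add: carter_metric_def power2_eq_square)

definition timelike :: "coords set \<Rightarrow> coords \<Rightarrow> bool" where
  "timelike p v \<longleftrightarrow> carter_metric p v v > 0"

definition lightlike :: "coords set \<Rightarrow> coords \<Rightarrow> bool" where
  "lightlike p v \<longleftrightarrow> carter_metric p v v = 0 \<and> v \<noteq> 0"

definition causal :: "coords set \<Rightarrow> coords \<Rightarrow> bool" where
  "causal p v \<longleftrightarrow> timelike p v \<or> lightlike p v"

definition same_causal_cone :: "coords set \<Rightarrow> coords \<Rightarrow> coords \<Rightarrow> bool" where
  "same_causal_cone p v w \<longleftrightarrow> connected_component (Collect (causal p)) v w"

definition future_directed :: "coords set \<Rightarrow> coords \<Rightarrow> bool" where
  "future_directed p v \<longleftrightarrow> same_causal_cone p (1, 0, 0) v"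

section \<open>Causal curves and Lorentzian distance\<close>

text \<open>
  The \<open>n\<close> pieces of a piecewise differentiable curve are its restrictions to the closed intervals
  between consecutive points of a subdivision \<open>\<sigma> 0 < \<dots> < \<sigma> n\<close>. Each piece is
  continuously differentiable up to and including its endpoints.
\<close>

definition subdivision :: "real \<Rightarrow> real \<Rightarrow> nat \<Rightarrow> (nat \<Rightarrow> real) \<Rightarrow> bool" where
  "subdivision \<tau>0 \<tau>1 n \<sigma> \<longleftrightarrow>
    0 < n \<and> \<sigma> 0 = \<tau>0 \<and> \<sigma> n = \<tau>1 \<and> (\<forall>i<n. \<sigma> i < \<sigma> (Suc i))"

definition piece_velocity ::
    "real \<Rightarrow> (nat \<Rightarrow> real) \<Rightarrow> (real \<Rightarrow> coords set) \<Rightarrow> nat \<Rightarrow> real \<Rightarrow> coords" where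
  "piece_velocity a \<sigma> \<alpha> i \<tau> = velocity a \<alpha> \<tau> {\<sigma> i..\<sigma> (Suc i)}"

definition piecewise_differentiable ::
    "real \<Rightarrow> nat \<Rightarrow> (nat \<Rightarrow> real) \<Rightarrow> (real \<Rightarrow> coords set) \<Rightarrow> bool" where
  "piecewise_differentiable a n \<sigma> \<alpha> \<longleftrightarrow>
    (\<forall>i<n. (\<forall>\<tau>\<in>{\<sigma> i..\<sigma> (Suc i)}. \<exists>v. has_velocity a \<alpha> v \<tau> {\<sigma> i..\<sigma> (Suc i)}) \<and>
      continuous_on {\<sigma> i..\<sigma> (Suc i)} (piece_velocity a \<sigma> \<alpha> i))"

definition causal_curve ::
    "real \<Rightarrow> nat \<Rightarrow> (nat \<Rightarrow> real) \<Rightarrow> (real \<Rightarrow> coords set) \<Rightarrow> bool" where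
  "causal_curve a n \<sigma> \<alpha> \<longleftrightarrow>
    piecewise_differentiable a n \<sigma> \<alpha> \<and>
    (\<forall>i<n. \<forall>\<tau>\<in>{\<sigma> i..\<sigma> (Suc i)}. causal (\<alpha> \<tau>) (piece_velocity a \<sigma> \<alpha> i \<tau>)) \<and>
    (\<forall>i. Suc i < n \<longrightarrow>
      same_causal_cone (\<alpha> (\<sigma> (Suc i)))
        (piece_velocity a \<sigma> \<alpha> i (\<sigma> (Suc i))) (piece_velocity a \<sigma> \<alpha> (Suc i) (\<sigma> (Suc i))))"

definition future_directed_curve ::
    "real \<Rightarrow> nat \<Rightarrow> (nat \<Rightarrow> real) \<Rightarrow> (real \<Rightarrow> coords set) \<Rightarrow> bool" where
  "future_directed_curve a n \<sigma> \<alpha> \<longleftrightarrow>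
    (\<forall>i<n. \<forall>\<tau>\<in>{\<sigma> i..\<sigma> (Suc i)}. future_directed (\<alpha> \<tau>) (piece_velocity a \<sigma> \<alpha> i \<tau>))"

text \<open>Elements are curves together with the endpoints of their parameter interval.\<close>

definition causal_curves ::
    "real \<Rightarrow> coords set \<Rightarrow> coords set \<Rightarrow> ((real \<Rightarrow> coords set) \<times> real \<times> real) set" where
  "causal_curves a p q = {(\<alpha>, \<tau>0, \<tau>1).
    \<alpha> \<tau>0 = p \<and> \<alpha> \<tau>1 = q \<and>
    (\<exists>n \<sigma>. subdivision \<tau>0 \<tau>1 n \<sigma> \<and> causal_curve a n \<sigma> \<alpha> \<and> future_directed_curve a n \<sigma> \<alpha>)}"

text \<open>The finitely many breaks, where the two-sided velocity need not exist, form a null set.\<close>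

definition curve_length :: "real \<Rightarrow> (real \<Rightarrow> coords set) \<Rightarrow> real \<Rightarrow> real \<Rightarrow> ennreal" where
  "curve_length a \<alpha> \<tau>0 \<tau>1 =
    (\<integral>\<^sup>+ \<tau> \<in> {\<tau>0..\<tau>1}. ennreal (sqrt \<bar>carter_metric (\<alpha> \<tau>)
        (velocity a \<alpha> \<tau> {\<tau>0..\<tau>1}) (velocity a \<alpha> \<tau> {\<tau>0..\<tau>1})\<bar>) \<partial>lborel)"

definition lorentzian_distance :: "real \<Rightarrow> coords set \<Rightarrow> coords set \<Rightarrow> ennreal" where
  "lorentzian_distance a p q = (SUP (\<alpha>, \<tau>0, \<tau>1) \<in> causal_curves a p q. curve_length a \<alpha> \<tau>0 \<tau>1)"

end

theory Submission
  imports Defs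
begin

text \<open>
  The length functional is unbounded because \<open>c\<close> vanishes to fourth order at \<open>t = 0\<close>. On curves
  \<open>t \<mapsto> (t, y(t), z(t))\<close> with \<open>y' = u \<le> 1 / c\<close> and bounded \<open>z'\<close> the speed is of order \<open>\<surd>u\<close>; for
  \<open>u\<close> of order \<open>1 / \<delta>\<^sup>4\<close> on \<open>\<bar>t\<bar> \<le> \<delta>\<close> the length is thus of order \<open>1 / \<delta>\<close>. Such a curve
  winds around the torus in the \<open>y\<close> direction more and more often as \<open>\<delta>\<close> tends to \<open>0\<close>, but rescaling
  \<open>u\<close> by a factor in \<open>[1/2, 1]\<close> makes the winding number an integer, and a slope of \<open>z\<close> in \<open>[0, 1)\<close> makes
  the end point independent of \<open>\<delta>\<close>.
\<close>

section \<open>Velocities of projected curves\<close>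

text \<open>Points of the ball are less than 1 apart, while every nonzero translation by
  \<open>(0, m, n + m * a)\<close> has norm at least 1: look at \<open>m\<close> first, then at
  \<open>n\<close> once \<open>m = 0\<close>.\<close>

lemma carter_chart_range_ball: "carter_chart_range a (ball x (1/2))"
  unfolding carter_chart_range_def
proof (intro conjI open_ball inj_onI)
  fix p q assume pq: "p \<in> ball x (1/2)" "q \<in> ball x (1/2)"
    and "carter_proj a p = carter_proj a q"
  then obtain m n :: int where q: "q = p + (0, of_int m, of_int n + of_int m * a)"
    unfolding carter_proj_eq_iff carter_rel_iff by blast
  have "dist q p < 1"
    using pq dist_triangle_half_r[of x q 1 p] by simp
  then have d: "norm (0::real, real_of_int m, of_int n + of_int m * a) < 1"
    by (simp add: q dist_norm)
  have "\<bar>real_of_int m\<bar> < 1"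
    using d norm_fst_le[of "real_of_int m" "of_int n + of_int m * a"] by simp
  then have m: "m = 0" by linarith
  have "\<bar>real_of_int n\<bar> < 1"
    using d m by (simp add: norm_Pair)
  then have "n = 0" by linarith
  with m q show "p = q" by (simp add: zero_prod_def[symmetric])
qed

text \<open>Near \<tau> the chart on the ball around \<open>x \<tau>\<close> recovers the lift
  \<open>x\<close> from its projection, so both have the same derivative.\<close>

lemma has_velocity_proj:
  assumes "(x has_vector_derivative v) (at \<tau> within S)" and "\<tau> \<in> S"
  shows "has_velocity a (\<lambda>s. carter_proj a (x s)) v \<tau> S"
proof -
  let ?U = "ball (x \<tau>) (1/2)" and ?F = "at \<tau> within S"
  have U: "carter_chart_range a ?U" by (rule carter_chart_range_ball)
  have "(x \<longlongrightarrow> x \<tau>) ?F"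
    using has_vector_derivative_continuous[OF assms(1)] by (simp add: continuous_within)
  then have ev: "\<forall>\<^sub>F s in ?F. x s \<in> ?U"
    by (rule topological_tendstoD) auto
  have inv: "inv_into ?U (carter_proj a) (carter_proj a (x s)) = x s" if "x s \<in> ?U" for s
    using U that unfolding carter_chart_range_def by (auto intro: inv_into_f_f)
  have "((\<lambda>s. inv_into ?U (carter_proj a) (carter_proj a (x s))) has_derivative (\<lambda>h. h *\<^sub>R v)) ?F"
  proof (rule has_derivative_transform_eventually)
    show "(x has_derivative (\<lambda>h. h *\<^sub>R v)) ?F"
      using assms by (simp add: has_vector_derivative_def)
    show "\<forall>\<^sub>F s in ?F. x s = inv_into ?U (carter_proj a) (carter_proj a (x s))"
      using ev by eventually_elim (simp only: inv)
  qed (use \<open>\<tau> \<in> S\<close> in \<open>simp_all add: inv\<close>)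
  then show ?thesis
    unfolding has_velocity_def has_vector_derivative_def
    by (intro exI[of _ ?U] conjI U eventually_mono[OF ev]) auto
qed

section \<open>Causal graphs over the time axis\<close>

text \<open>Scaling \<open>(u, w)\<close> by \<open>s\<close> in [0, 1] joins
  \<open>(1, 0, 0)\<close> to \<open>(1, u, w)\<close>. With c for \<open>carter_c t\<close>, the
  metric takes the value c + s (2 u - s (c u^2 + w^2)) on this segment, which is nonnegative, so the
  segment never leaves the causal cone.\<close>

lemma future_directed_graph:
  assumes "0 \<le> u" and "carter_c t * u\<^sup>2 + w\<^sup>2 \<le> 2 * u"
  shows "causal (carter_proj a (t, y, z)) (1, u, w)"
    and "future_directed (carter_proj a (t, y, z)) (1, u, w)"
proof -
  let ?p = "carter_proj a (t, y, z)"
  have c: "0 \<le> carter_c t" by (simp add: carter_c_def)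
  have seg: "causal ?p (1, s * u, s * w)" if s: "0 \<le> s" "s \<le> 1" for s
  proof -
    have "s * (carter_c t * u\<^sup>2 + w\<^sup>2) \<le> carter_c t * u\<^sup>2 + w\<^sup>2"
      using s c by (intro mult_left_le_one_le) auto
    also note assms(2)
    finally have "0 \<le> s * (2 * u - s * (carter_c t * u\<^sup>2 + w\<^sup>2))"
      using s by (intro mult_nonneg_nonneg) auto
    then have "0 \<le> carter_metric ?p (1, s * u, s * w) (1, s * u, s * w)"
      using c by (simp add: carter_metric_quadratic algebra_simps power2_eq_square)
    then show ?thesis
      by (auto simp: causal_def timelike_def lightlike_def zero_prod_def)
  qed
  from seg[of 1] show "causal ?p (1, u, w)" by simp
  have "connected_component (Collect (causal ?p)) (1, 0 * u, 0 * w) (1, 1 * u, 1 * w)"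
    unfolding connected_component_def
  proof (intro exI conjI)
    show "connected ((\<lambda>s. (1::real, s * u, s * w)) ` {0..1})"
      by (intro connected_continuous_image continuous_intros) simp
  qed (use seg in auto)
  then show "future_directed ?p (1, u, w)"
    by (simp add: future_directed_def same_causal_cone_def)
qed

lemma
  fixes a t0 t1 :: real
  assumes "t0 < t1"
    and y: "\<And>t. t \<in> {t0..t1} \<Longrightarrow> (y has_vector_derivative u t) (at t within {t0..t1})"
    and z: "\<And>t. t \<in> {t0..t1} \<Longrightarrow> (z has_vector_derivative w t) (at t within {t0..t1})"
    and u: "continuous_on {t0..t1} u" and w: "continuous_on {t0..t1} w"
    and nonneg: "\<And>t. t \<in> {t0..t1} \<Longrightarrow> 0 \<le> u t"
    and bound: "\<And>t. t \<in> {t0..t1} \<Longrightarrow> carter_c t * (u t)\<^sup>2 + (w t)\<^sup>2 \<le> 2 * u t"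
  defines "\<alpha> \<equiv> \<lambda>t. carter_proj a (t, y t, z t)"
  shows graph_in_causal_curves:
      "(\<alpha>, t0, t1) \<in> causal_curves a (carter_proj a (t0, y t0, z t0)) (carter_proj a (t1, y t1, z t1))"
    and curve_length_graph:
      "curve_length a \<alpha> t0 t1 = (\<integral>\<^sup>+ t \<in> {t0..t1}.
        ennreal (sqrt (carter_c t * (1 - (u t)\<^sup>2) + 2 * u t - (w t)\<^sup>2)) \<partial>lborel)"
proof -
  have \<alpha>: "\<alpha> t = carter_proj a (t, y t, z t)" for t
    by (simp add: \<alpha>_def)
  have hv: "has_velocity a \<alpha> (1, u t, w t) t {t0..t1}" if "t \<in> {t0..t1}" for t
    unfolding \<alpha>_def
    by (intro has_velocity_proj has_vector_derivative_Pair y z that has_vector_derivative_id)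
  have nontriv: "at t within {t0..t1} \<noteq> bot" if "t \<in> {t0..t1}" for t
    using that \<open>t0 < t1\<close> by (simp add: trivial_limit_within)
  have v: "velocity a \<alpha> t {t0..t1} = (1, u t, w t)" if "t \<in> {t0..t1}" for t
    using hv that nontriv by (intro velocity_eq) auto
  \<comment> \<open>One piece is enough, and its velocity is then the velocity on the whole interval
    that \<open>curve_length\<close> refers to.\<close>
  define \<sigma> where "\<sigma> i = (if i = 0 then t0 else t1)" for i :: nat
  have \<sigma>: "\<sigma> 0 = t0" "\<sigma> (Suc 0) = t1" by (auto simp: \<sigma>_def)
  have "continuous_on {t0..t1} (\<lambda>t. (1::real, u t, w t))"
    by (intro continuous_intros u w)
  then have "continuous_on {t0..t1} (piece_velocity a \<sigma> \<alpha> 0)"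
    by (rule continuous_on_eq) (simp add: piece_velocity_def \<sigma> v)
  then have "piecewise_differentiable a 1 \<sigma> \<alpha>"
    unfolding piecewise_differentiable_def less_one using hv by (metis \<sigma>)
  then have "causal_curve a 1 \<sigma> \<alpha>"
    using future_directed_graph(1)[OF nonneg bound]
    by (auto simp: causal_curve_def piece_velocity_def \<sigma> v \<alpha>)
  moreover have "future_directed_curve a 1 \<sigma> \<alpha>"
    using future_directed_graph(2)[OF nonneg bound]
    by (auto simp: future_directed_curve_def piece_velocity_def \<sigma> v \<alpha>)
  moreover have "subdivision t0 t1 1 \<sigma>"
    using \<open>t0 < t1\<close> by (simp add: subdivision_def \<sigma>)
  ultimately show "(\<alpha>, t0, t1) \<in>
      causal_curves a (carter_proj a (t0, y t0, z t0)) (carter_proj a (t1, y t1, z t1))"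
    unfolding causal_curves_def by (auto simp: \<alpha>_def)
  show "curve_length a \<alpha> t0 t1 = (\<integral>\<^sup>+ t \<in> {t0..t1}.
        ennreal (sqrt (carter_c t * (1 - (u t)\<^sup>2) + 2 * u t - (w t)\<^sup>2)) \<partial>lborel)"
    unfolding curve_length_def
  proof (intro nn_integral_cong)
    fix t
    show "ennreal (sqrt \<bar>carter_metric (\<alpha> t) (velocity a \<alpha> t {t0..t1}) (velocity a \<alpha> t {t0..t1})\<bar>) *
        indicator {t0..t1} t =
      ennreal (sqrt (carter_c t * (1 - (u t)\<^sup>2) + 2 * u t - (w t)\<^sup>2)) * indicator {t0..t1} t"
    proof (cases "t \<in> {t0..t1}")
      case True
      have "0 \<le> carter_c t * (1 - (u t)\<^sup>2) + 2 * u t - (w t)\<^sup>2"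
        using bound[OF True] by (simp add: carter_c_def algebra_simps add_increasing2)
      then show ?thesis
        using v[OF True] by (simp add: \<alpha> carter_metric_quadratic)
    qed simp
  qed
qed

section \<open>Long curves between fixed end points\<close>

lemma cosh_minus_one_le_square:
  fixes t :: real
  assumes "\<bar>t\<bar> \<le> 1"
  shows "cosh t - 1 \<le> t\<^sup>2"
proof -
  have *: "cosh s - 1 \<le> s\<^sup>2" if s: "0 \<le> s" "s \<le> 1" for s :: real
  proof -
    \<comment> \<open>The product equals 1 + s^3.\<close>
    have "1 \<le> (1 - s + s\<^sup>2) * (1 + s)"
      using s by (simp add: algebra_simps power2_eq_square)
    also have "\<dots> \<le> (1 - s + s\<^sup>2) * exp s"
      using s by (intro mult_left_mono) auto
    finally have "exp (- s) \<le> 1 - s + s\<^sup>2"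
      by (simp add: exp_minus field_simps)
    moreover have "exp s \<le> 1 + s + s\<^sup>2"
      using s by (rule exp_bound)
    ultimately have "exp s + exp (- s) \<le> 2 * (1 + s\<^sup>2)"
      by (simp add: algebra_simps)
    then show ?thesis
      by (simp add: cosh_field_def field_simps)
  qed
  show ?thesis
    using *[of "\<bar>t\<bar>"] assms by (cases "0 \<le> t") auto
qed

lemma carter_c_le: "\<bar>t\<bar> \<le> 1 \<Longrightarrow> carter_c t \<le> t ^ 4"
  using power_mono[OF cosh_minus_one_le_square, of t 2]
  by (simp add: carter_c_def cosh_real_ge_1)

text \<open>The curve built here has speed at least 1 / (4 \<delta>^2) on an interval of length 2
  \<delta>.\<close>

lemma lorentzian_distance_ge:
  fixes \<delta> :: real
  assumes "0 < \<delta>" "\<delta> \<le> 1/2"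
  shows "ennreal (1 / (2 * \<delta>)) \<le>
    lorentzian_distance a (carter_proj a (-1/2, 0, 0)) (carter_proj a (1/2, 0, 0))"
proof -
  let ?J = "{-1/2..1/2::real}"
  \<comment> \<open>A continuous substitute for 1 / c: since c \<le> t^4 for
    \<open>\<bar>t\<bar> \<le> 1\<close>, it satisfies c u0 \<le> 1.\<close>
  define u0 where "u0 t = 1 / (t ^ 4 + \<delta> ^ 4)" for t :: real
  define I where "I = integral ?J u0"
  \<comment> \<open>Chosen so that \<open>u\<close> integrates to the integer floor of
    \<open>I\<close>; the bound \<open>8 \<le> I\<close> keeps \<theta> above 1/2.\<close>
  define \<theta> where "\<theta> = of_int \<lfloor>I\<rfloor> / I"
  define u where "u t = \<theta> * u0 t" for t
  define y where "y t = integral {-1/2..t} u" for t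
  \<comment> \<open>The total rise of \<open>z\<close>. It differs by an integer from the shift in
    \<open>z\<close> that the identifications attach to the winding in \<open>y\<close>, and it
    stays below 1 for all \<delta>.\<close>
  define w where "w = frac (of_int \<lfloor>I\<rfloor> * a)"
  define z where "z t = w * (t + 1/2)" for t :: real
  have pos: "0 < t ^ 4 + \<delta> ^ 4" for t :: real
    using assms by (simp add: add_nonneg_pos)
  have \<delta>4: "\<delta> ^ 4 \<le> 1/16"
    using power_mono[OF assms(2), of 4] assms(1) by (simp add: power_divide)
  have t4: "t ^ 4 \<le> 1/16" if "t \<in> ?J" for t
  proof -
    have "\<bar>t\<bar> ^ 4 \<le> (1/2) ^ 4" using that by (intro power_mono) auto
    then show ?thesis by (simp add: power_divide)
  qed
  \<comment> \<open>Both fourth powers are at most 1/16. The resulting \<open>4 \<le> u t\<close>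
    later lets \<open>u\<close> absorb \<open>w^2\<close>.\<close>
  have u0_ge: "8 \<le> u0 t" if "t \<in> ?J" for t
    using t4[OF that] \<delta>4 pos[of t] by (simp add: u0_def field_simps)
  have u0_cont: "continuous_on ?J u0"
    unfolding u0_def using pos by (intro continuous_intros) (metis less_irrefl)
  have u_cont: "continuous_on ?J u"
    unfolding u_def by (intro continuous_intros u0_cont)
  have "integral ?J (\<lambda>t. 8) \<le> I"
    unfolding I_def using u0_ge
    by (intro integral_le integrable_continuous_real u0_cont) auto
  then have I: "8 \<le> I" by simp
  have \<theta>: "1/2 \<le> \<theta>" "\<theta> \<le> 1"
    using I by (auto simp: \<theta>_def field_simps) linarith
  have u_ge: "u0 t / 2 \<le> u t" and u_le: "u t \<le> u0 t" if "t \<in> ?J" for t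
    using mult_right_mono[OF \<theta>(1), of "u0 t"] mult_right_mono[OF \<theta>(2), of "u0 t"] u0_ge[OF that]
    by (auto simp: u_def)
  have u4: "4 \<le> u t" if "t \<in> ?J" for t
    using u_ge[OF that] u0_ge[OF that] by linarith
  have cu: "carter_c t * (u t)\<^sup>2 \<le> u t" if "t \<in> ?J" for t
  proof -
    have "carter_c t * u t \<le> (t ^ 4 + \<delta> ^ 4) * u0 t"
      using carter_c_le[of t] that assms(1) u_le[OF that] u4[OF that] pos[of t]
      by (intro mult_mono) (auto simp: add_increasing2)
    also have "\<dots> = 1" using pos[of t] by (simp add: u0_def)
    finally show ?thesis
      using mult_right_mono[of "carter_c t * u t" 1 "u t"] u4[OF that]
      by (simp add: power2_eq_square mult.assoc)
  qed
  have w: "w\<^sup>2 \<le> 1"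
    using frac_lt_1[of "of_int \<lfloor>I\<rfloor> * a"] by (simp add: w_def power_le_one)
  have y': "(y has_vector_derivative u t) (at t within ?J)" if "t \<in> ?J" for t
    unfolding y_def using u_cont that by (rule integral_has_vector_derivative)
  have z': "(z has_vector_derivative w) (at t within ?J)" for t
    unfolding z_def by (auto intro!: derivative_eq_intros
      simp: has_real_derivative_iff_has_vector_derivative[symmetric])
  have y1: "y (1/2) = of_int \<lfloor>I\<rfloor>"
  proof -
    have "y (1/2) = \<theta> * I"
      unfolding y_def I_def u_def[abs_def] by (rule integral_mult_right)
    then show ?thesis using I by (simp add: \<theta>_def)
  qed
  have bound: "carter_c t * (u t)\<^sup>2 + w\<^sup>2 \<le> 2 * u t" if "t \<in> ?J" for t
    using cu[OF that] u4[OF that] w by linarith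
  have nonneg: "0 \<le> u t" if "t \<in> ?J" for t
    using u4[OF that] by linarith
  let ?\<alpha> = "\<lambda>t. carter_proj a (t, y t, z t)"
  note graph = graph_in_causal_curves[OF _ y' z' u_cont continuous_on_const nonneg bound, of a]
    and len = curve_length_graph[OF _ y' z' u_cont continuous_on_const nonneg bound, of a]
  have start: "y (-1/2) = 0" "z (-1/2) = 0"
    by (auto simp: y_def z_def)
  have "((1/2, 0, 0), (1/2, y (1/2), z (1/2))) \<in> carter_rel a"
    unfolding carter_rel_iff
    by (intro exI[of _ "\<lfloor>I\<rfloor>"] exI[of _ "- \<lfloor>of_int \<lfloor>I\<rfloor> * a\<rfloor>"]) (simp add: y1 z_def w_def frac_def)
  then have fin: "carter_proj a (1/2, y (1/2), z (1/2)) = carter_proj a (1/2, 0, 0)"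
    by (simp add: carter_proj_eq_iff[symmetric])
  have curve: "(?\<alpha>, -1/2, 1/2) \<in>
      causal_curves a (carter_proj a (-1/2, 0, 0)) (carter_proj a (1/2, 0, 0))"
    using graph start fin by simp
  have speed: "1 / (4 * \<delta>\<^sup>2) \<le> sqrt (carter_c t * (1 - (u t)\<^sup>2) + 2 * u t - w\<^sup>2)"
    if t: "t \<in> {-\<delta>..\<delta>}" for t
  proof (rule real_le_rsqrt)
    have tJ: "t \<in> ?J" using t assms by auto
    have "\<bar>t\<bar> ^ 4 \<le> \<delta> ^ 4" using t by (intro power_mono) auto
    then have "1 / (2 * \<delta> ^ 4) \<le> u0 t"
      unfolding u0_def using pos[of t] assms(1) by (intro divide_left_mono mult_pos_pos) auto
    then have "1 / (8 * \<delta> ^ 4) \<le> u t / 2"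
      using u_ge[OF tJ] by simp
    moreover have "(1 / (4 * \<delta>\<^sup>2))\<^sup>2 \<le> 1 / (8 * \<delta> ^ 4)"
      using assms(1) by (simp add: power_divide power_mult_distrib field_simps)
    \<comment> \<open>By c u^2 \<le> u and w^2 \<le> 1 the right-hand side is at least u - 1, and u
      \<ge> 4.\<close>
    moreover have "u t / 2 \<le> carter_c t * (1 - (u t)\<^sup>2) + 2 * u t - w\<^sup>2"
    proof -
      have "0 \<le> carter_c t" by (simp add: carter_c_def)
      then show ?thesis
        using cu[OF tJ] u4[OF tJ] w by (simp add: algebra_simps)
    qed
    ultimately show "(1 / (4 * \<delta>\<^sup>2))\<^sup>2 \<le> carter_c t * (1 - (u t)\<^sup>2) + 2 * u t - w\<^sup>2"
      by linarith
  qed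
  have "ennreal (1 / (2 * \<delta>)) = ennreal (1 / (4 * \<delta>\<^sup>2)) * ennreal (2 * \<delta>)"
    using assms(1) by (simp add: ennreal_mult[symmetric] power2_eq_square)
  also have "\<dots> = (\<integral>\<^sup>+ t \<in> {-\<delta>..\<delta>}. ennreal (1 / (4 * \<delta>\<^sup>2)) \<partial>lborel)"
    using assms(1) by (simp add: nn_integral_cmult_indicator)
  also have "\<dots> \<le> (\<integral>\<^sup>+ t \<in> ?J.
      ennreal (sqrt (carter_c t * (1 - (u t)\<^sup>2) + 2 * u t - w\<^sup>2)) \<partial>lborel)"
    using speed assms
    by (intro nn_integral_mono) (auto simp: indicator_def intro!: ennreal_leI)
  also have "\<dots> = curve_length a ?\<alpha> (-1/2) (1/2)"
    using len by simp
  also have "\<dots> \<le> lorentzian_distance a (carter_proj a (-1/2, 0, 0)) (carter_proj a (1/2, 0, 0))"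
    unfolding lorentzian_distance_def by (rule SUP_upper2[OF curve]) simp
  finally show ?thesis .
qed

theorem proposition2p1:
  fixes a :: real
  assumes "0 < a" and "a < 1" and "a \<notin> \<rat>"
  shows "\<exists>p \<in> carter_space a. \<exists>q \<in> carter_space a. lorentzian_distance a p q = \<infinity>"
proof (intro bexI)
  let ?d = "lorentzian_distance a (carter_proj a (-1/2, 0, 0)) (carter_proj a (1/2, 0, 0))"
  \<comment> \<open>For positive \<open>n\<close>, the choice \<delta> = 1 / (2 n) turns the bound 1
    / (2 \<delta>) into \<open>n\<close>.\<close>
  have "of_nat n \<le> ?d" for n
  proof (cases "n = 0")
    case False
    then show ?thesis
      using lorentzian_distance_ge[of "1 / (2 * real n)" a] by (simp add: ennreal_of_nat_eq_real_of_nat)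
  qed simp
  then show "?d = \<infinity>"
    by (metis ennreal_Ex_less_of_nat infinity_ennreal_def leD top.not_eq_extremum)
qed (auto simp: carter_space_def carter_proj_def intro: quotientI)

end
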